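(* Let $s$ be a positive integer and let $m_1,\dots,m_s$ be pairwise coprime positive integers such that each $m_i$ ($1\le i\le s$) divides $m_1+m_2+\dots+m_s$. For each positive integer $n$ let $$a_n=\frac{((m_1+m_2+\dots+m_s)n)!}{(m_1n)!\,(m_2n)!\cdots(m_sn)!}.$$ Then the sequence $(a_n)_{n\ge1}$ is mean divisible, i.e. $\prod_{n=1}^t a_n$ divides $\prod_{n=1}^t a_{kn}$ for all positive integers $k$ and $t$.
   Context: A sequence $(a_n)_{n\ge1}$ of nonzero integers is called mean divisible if $\prod_{n=1}^t a_n \mid \prod_{n=1}^t a_{kn}$ for all positive integers $k$ and $t$. *)

theory Defs
  imports Complex_Main
begin

text \<open>A sequence \<open>(a\<^sub>n)\<close>, \<open>n \<ge> 1\<close>, of nonzero integers; the value \<open>a 0\<close> is irrelevant.\<close>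

definition mean_divisible :: "(nat \<Rightarrow> int) \<Rightarrow> bool" where
  "mean_divisible a \<longleftrightarrow>
     (\<forall>n\<ge>1. a n \<noteq> 0) \<and>
     (\<forall>k\<ge>1. \<forall>t\<ge>1. (\<Prod>n=1..t. a n) dvd (\<Prod>n=1..t. a (k * n)))"

text \<open>The integer division is exact; see \<open>multinomial_seq_eq\<close> below.\<close>

definition multinomial_seq :: "nat \<Rightarrow> (nat \<Rightarrow> nat) \<Rightarrow> nat \<Rightarrow> int" where
  "multinomial_seq s m n =
     fact ((\<Sum>i=1..s. m i) * n) div (\<Prod>i=1..s. fact (m i * n))"

lemma prod_fact_dvd_fact_sum:
  assumes "finite A"
  shows "(\<Prod>i\<in>A. fact (f i)) dvd (fact (\<Sum>i\<in>A. f i) :: int)"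
  using assms
proof (induction A rule: finite_induct)
  case empty
  show ?case by simp
next
  case (insert x A)
  have "fact (f x) * (\<Prod>i\<in>A. fact (f i)) dvd (fact (f x) * fact (\<Sum>i\<in>A. f i) :: int)"
    using insert.IH by (rule mult_dvd_mono[OF dvd_refl])
  also have "\<dots> dvd fact (f x + (\<Sum>i\<in>A. f i))"
    by (rule fact_fact_dvd_fact)
  finally show ?case
    using insert.hyps by simp
qed

lemma multinomial_seq_eq:
  "real_of_int (multinomial_seq s m n) =
     fact ((\<Sum>i=1..s. m i) * n) / (\<Prod>i=1..s. fact (m i * n))"
proof -
  have "(\<Prod>i=1..s. fact (m i * n)) dvd (fact ((\<Sum>i=1..s. m i) * n) :: int)"
    using prod_fact_dvd_fact_sum[of "{1..s}" "\<lambda>i. m i * n"]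
    by (simp add: sum_distrib_right)
  then show ?thesis
    by (simp add: multinomial_seq_def real_of_int_div)
qed

end

theory Submission
  imports Defs "HOL-Number_Theory.Number_Theory"
begin

text \<open>
  Write \<open>M = m\<^sub>1 + \<dots> + m\<^sub>s\<close>. By Legendre's formula the \<open>p\<close>-adic valuation of \<open>a\<^sub>n\<close> is the sum,
  over the powers \<open>q\<close> of \<open>p\<close>, of \<open>f\<^sub>q n = \<lfloor>M n / q\<rfloor> - (\<Sum>i. \<lfloor>m\<^sub>i n / q\<rfloor>)\<close>, which is periodic in \<open>n\<close>
  with period \<open>q\<close>. Along \<open>0 \<le> x < 1\<close> the map \<open>\<lfloor>M x\<rfloor> - (\<Sum>i. \<lfloor>m\<^sub>i x\<rfloor>)\<close> is nondecreasing: as \<open>m\<^sub>i\<close>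
  divides \<open>M\<close>, each downward jump at some \<open>j / m\<^sub>i\<close> is compensated by an upward jump of
  \<open>\<lfloor>M x\<rfloor>\<close>, and by coprimality no two of the \<open>m\<^sub>i\<close> jump at the same point. Hence \<open>f\<^sub>q\<close> is
  nondecreasing on \<open>{0..<q}\<close>, so among all sets of \<open>r < q\<close> nonzero residues its sum is minimal
  on \<open>{1..r}\<close>; for \<open>k\<close> coprime to \<open>p\<close>, multiplication by \<open>k\<close> permutes the nonzero residues
  modulo \<open>q\<close>. Factors \<open>p\<close> of \<open>k\<close> do not matter, since \<open>a\<^sub>n\<close> and \<open>a\<^bsub>p n\<^esub>\<close> have the same
  valuation.
\<close>

subsection \<open>Rearrangement and periodicity\<close>

text \<open>Exchange argument with \<open>r = card S\<close>: \<open>S - {1..r}\<close> and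
  \<open>{1..r} - S\<close> are equinumerous, and the value \<open>f r\<close> bounds
  \<open>f\<close> from below on the first and from above on the second.\<close>

lemma sum_initial_segment_le:
  fixes f :: "nat \<Rightarrow> int"
  assumes mono: "\<And>x y. 1 \<le> x \<Longrightarrow> x \<le> y \<Longrightarrow> y < q \<Longrightarrow> f x \<le> f y"
    and S: "S \<subseteq> {1..<q}" "card S < q"
  shows "sum f {1..card S} \<le> sum f S"
proof (cases "S = {}")
  case False
  define r where "r = card S"
  have fin: "finite S" using S(1) finite_subset by blast
  have r: "1 \<le> r" "r < q"
    using False fin S(2) by (auto simp: r_def Suc_le_eq card_gt_0_iff)
  have card_eq: "card (S - {1..r}) = card ({1..r} - S)"
    using card_Diff_subset_Int[of S "{1..r}"] card_Diff_subset_Int[of "{1..r}" S] fin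
    by (simp add: r_def Int_commute)
  have "sum f ({1..r} - S) \<le> of_nat (card ({1..r} - S)) * f r"
    by (rule sum_bounded_above) (use mono r in auto)
  also have "\<dots> = of_nat (card (S - {1..r})) * f r"
    by (simp only: card_eq)
  also have "\<dots> \<le> sum f (S - {1..r})"
  proof (rule sum_bounded_below)
    fix x assume "x \<in> S - {1..r}"
    then have "r \<le> x" "x < q" using S(1) by auto
    then show "f r \<le> f x" using mono r by blast
  qed
  finally have "sum f ({1..r} - S) \<le> sum f (S - {1..r})" .
  moreover have "sum f {1..r} = sum f ({1..r} \<inter> S) + sum f ({1..r} - S)"
    by (rule sum.Int_Diff) simp
  moreover have "sum f S = sum f (S \<inter> {1..r}) + sum f (S - {1..r})"
    by (rule sum.Int_Diff) (fact fin)
  ultimately show ?thesis by (simp add: r_def Int_commute)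
qed simp

lemma inj_on_mult_mod:
  fixes k q :: nat
  assumes "coprime k q"
  shows "inj_on (\<lambda>n. k * n mod q) {..<q}"
proof (rule inj_onI)
  fix x y assume xy: "x \<in> {..<q}" "y \<in> {..<q}" "k * x mod q = k * y mod q"
  then have "[k * x = k * y] (mod q)" by (simp add: cong_def)
  then have "[x = y] (mod q)" using assms by (simp add: cong_mult_lcancel_nat)
  then show "x = y" using xy by (simp add: cong_def)
qed

lemma sum_mult_mod:
  fixes f :: "nat \<Rightarrow> 'a::comm_monoid_add" and k q :: nat
  assumes "coprime k q" "q > 0"
  shows "(\<Sum>n<q. f (k * n mod q)) = sum f {..<q}"
proof -
  have "(\<lambda>n. k * n mod q) ` {..<q} = {..<q}"
    by (rule endo_inj_surj) (use inj_on_mult_mod assms in auto)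
  then have "bij_betw (\<lambda>n. k * n mod q) {..<q} {..<q}"
    using inj_on_mult_mod[OF assms(1)] by (simp add: bij_betw_def)
  then show ?thesis by (rule sum.reindex_bij_betw)
qed

text \<open>Peels off one full period. It is written as \<open>{..<q}\<close> rather than
  \<open>{1..q}\<close>, using \<open>h q = h 0\<close>, to match the residue system of
  \<open>sum_mult_mod\<close>.\<close>

lemma sum_period_split:
  fixes h :: "nat \<Rightarrow> 'a::comm_monoid_add"
  assumes "\<And>n. h (n + q) = h n"
  shows "sum h {1..q + t} = sum h {..<q} + sum h {1..t}"
proof (cases "q = 0")
  case False
  have "sum h {1..q + t} = sum h {1..q} + sum h {q + 1..q + t}"
    by (rule sum.ub_add_nat) simp
  also have "sum h {q + 1..q + t} = sum (\<lambda>n. h (n + q)) {1..t}"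
    using sum.shift_bounds_cl_nat_ivl[of h 1 q t] by (simp add: add.commute)
  also have "{1..q} = insert q {1..<q}" using False by auto
  also have "sum h \<dots> = sum h (insert 0 {1..<q})" using assms[of 0] by simp
  also have "insert 0 {1..<q} = {..<q}" using False by auto
  finally show ?thesis using assms by simp
qed simp

text \<open>A full period contributes the same to both sides, so induction reduces to
  \<open>t < q\<close>. There the residues of \<open>k * n\<close> are \<open>t\<close> distinct
  nonzero ones, and the exchange argument applies.\<close>

lemma sum_periodic_mult_ge:
  fixes f :: "nat \<Rightarrow> int"
  assumes mono: "\<And>x y. 1 \<le> x \<Longrightarrow> x \<le> y \<Longrightarrow> y < q \<Longrightarrow> f x \<le> f y"
    and periodic: "\<And>n. f (n mod q) = f n"
    and k: "coprime k q" and q: "q > 0"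
  shows "(\<Sum>n=1..t. f n) \<le> (\<Sum>n=1..t. f (k * n))"
proof (induction t rule: less_induct)
  case (less t)
  show ?case
  proof (cases "t < q")
    case True
    have inj: "inj_on (\<lambda>n. k * n mod q) {1..t}"
      by (rule inj_on_subset[OF inj_on_mult_mod[OF k]]) (use True in auto)
    let ?S = "(\<lambda>n. k * n mod q) ` {1..t}"
    have card: "card ?S = t" using card_image[OF inj] by simp
    have "k * n mod q \<noteq> 0" if "n \<in> {1..t}" for n
    proof
      assume "k * n mod q = 0"
      then have "q dvd n"
        using k by (metis coprime_commute coprime_dvd_mult_right_iff mod_0_imp_dvd)
      then show False using that True by (auto dest: dvd_imp_le)
    qed
    then have "?S \<subseteq> {1..<q}" using q by (force simp: Suc_le_eq)
    then have "sum f {1..t} \<le> sum f ?S"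
      using sum_initial_segment_le[of q f ?S] mono True card by simp
    also have "\<dots> = (\<Sum>n=1..t. f (k * n mod q))"
      using inj by (simp add: sum.reindex)
    finally show ?thesis by (simp add: periodic)
  next
    case False
    define u where "u = t - q"
    have t: "t = q + u" "u < t" using False q by (auto simp: u_def)
    have 1: "f (n + q) = f n" for n
      using periodic[of "n + q"] periodic[of n] by simp
    have 2: "f (k * (n + q)) = f (k * n)" for n
      using periodic[of "k * (n + q)"] periodic[of "k * n"] by (simp add: distrib_left)
    have "(\<Sum>n<q. f (k * n)) = sum f {..<q}"
      using sum_mult_mod[OF k q, of f] by (simp add: periodic)
    then show ?thesis
      using sum_period_split[of f q u, OF 1] sum_period_split[of "\<lambda>n. f (k * n)" q u, OF 2]
        less.IH[OF t(2)] t(1) by simp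
  qed
qed

subsection \<open>The floor function excess\<close>

definition floor_excess :: "'i set \<Rightarrow> ('i \<Rightarrow> nat) \<Rightarrow> nat \<Rightarrow> nat \<Rightarrow> int" where
  "floor_excess I m q n = int (sum m I * n div q) - (\<Sum>i\<in>I. int (m i * n div q))"

lemma floor_excess_1 [simp]: "floor_excess I m 1 n = 0"
  by (simp add: floor_excess_def sum_distrib_right)

lemma floor_excess_mult_cancel:
  "c > 0 \<Longrightarrow> floor_excess I m (c * q) (c * n) = floor_excess I m q n"
  by (simp add: floor_excess_def mult.left_commute)

text \<open>Reducing \<open>n\<close> lowers each quotient by its coefficient times
  \<open>n div q\<close>; these changes cancel because the coefficients \<open>m i\<close> add up to
  \<open>sum m I\<close>.\<close>

lemma floor_excess_mod:
  assumes "q > 0"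
  shows "floor_excess I m q (n mod q) = floor_excess I m q n"
proof -
  have div_split: "a * n div q = a * (n mod q) div q + a * (n div q)" for a
  proof -
    have "a * n = a * (n mod q) + q * (a * (n div q))"
      by (metis distrib_left mod_mult_div_eq mult.left_commute)
    then show ?thesis using assms by simp
  qed
  show ?thesis
    by (simp add: floor_excess_def div_split[of _] sum.distrib flip: sum_distrib_right)
qed

lemma floor_excess_mono:
  assumes fin: "finite I"
    and pos: "\<And>i. i \<in> I \<Longrightarrow> m i > 0"
    and cop: "\<And>i j. i \<in> I \<Longrightarrow> j \<in> I \<Longrightarrow> i \<noteq> j \<Longrightarrow> coprime (m i) (m j)"
    and dvd: "\<And>i. i \<in> I \<Longrightarrow> m i dvd sum m I"
    and xy: "x \<le> y" "y < q"
  shows "floor_excess I m q x \<le> floor_excess I m q y"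
proof -
  define M where "M = sum m I"
  \<comment> \<open>The jump points \<open>j / m i\<close> of the i-th floor function in the
    half-open interval from \<open>x / q\<close> to \<open>y / q\<close>.\<close>
  define J where "J = (\<lambda>i. {m i * x div q<..m i * y div q})"
  \<comment> \<open>Rewrites the jump point \<open>j / m i\<close> as \<open>c i * j / M\<close>, a
    jump point of the leading term.\<close>
  define c where "c = (\<lambda>i. M div m i)"
  have q: "q > 0" using xy by simp
  have J_iff: "j \<in> J i \<longleftrightarrow> m i * x < j * q \<and> j * q \<le> m i * y" for i j
    using q by (simp add: J_def div_less_iff_less_mult less_eq_div_iff_mult_less_eq)
  have c: "M = c i * m i" "c i > 0" if "i \<in> I" for i
  proof -
    show "M = c i * m i" using dvd[OF that] by (simp add: c_def M_def)
    have "M > 0" unfolding M_def using pos that fin by (auto simp: sum_pos2 intro: sum_pos)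
    then show "c i > 0" using \<open>M = c i * m i\<close> by (auto intro: Nat.gr0I)
  qed
  \<comment> \<open>Since \<open>y < q\<close>, jump points lie strictly between 0 and 1; this
    excludes the common jumps at integers.\<close>
  have small: "0 < j" "j < m i" if "j \<in> J i" "i \<in> I" for i j
  proof -
    have "0 < j * q" using that by (intro le_less_trans[of 0 "m i * x"]) (auto simp only: J_iff)
    then show "0 < j" by (auto intro: Nat.gr0I)
    have "j * q \<le> m i * y" using that by (simp add: J_iff)
    also have "m i * y < m i * q" using pos that xy by simp
    finally show "j < m i" by simp
  qed
  have "inj_on (\<lambda>(i, j). c i * j) (Sigma I J)"
  proof (rule inj_onI, clarify)
    fix i j i' j'
    assume ij: "i \<in> I" "j \<in> J i" "i' \<in> I" "j' \<in> J i'" and eq: "c i * j = c i' * j'"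
    have "i = i'"
    proof (rule ccontr)
      assume "i \<noteq> i'"
      then have "coprime (m i) (m i')" using cop ij by blast
      \<comment> \<open>Clearing denominators in \<open>j / m i = j' / m i'\<close>.\<close>
      have "M * (j * m i') = (c i * j) * m i * m i'" using c[OF ij(1)] by simp
      also have "\<dots> = M * (j' * m i)" using eq c[OF ij(3)] by simp
      finally have "j * m i' = j' * m i"
        using c[OF ij(1)] pos[OF ij(1)] by simp
      then have "m i dvd j * m i'" by simp
      then have "m i dvd j" using \<open>coprime (m i) (m i')\<close> by (simp add: coprime_dvd_mult_left_iff)
      then show False using small[OF ij(2,1)] by (auto dest: dvd_imp_le)
    qed
    then show "i = i' \<and> j = j'" using eq c[OF ij(1)] by simp
  qed
  moreover have "(\<lambda>(i, j). c i * j) ` Sigma I J \<subseteq> {M * x div q<..M * y div q}"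
  proof clarify
    fix i j assume ij: "i \<in> I" "j \<in> J i"
    then have "m i * x < j * q" "j * q \<le> m i * y" by (auto simp: J_iff)
    then have "c i * (m i * x) < c i * (j * q)" "c i * (j * q) \<le> c i * (m i * y)"
      using c[OF ij(1)] by auto
    then show "c i * j \<in> {M * x div q<..M * y div q}"
      using q c(1)[OF ij(1)]
      by (simp add: div_less_iff_less_mult less_eq_div_iff_mult_less_eq mult.assoc)
  qed
  ultimately have "card (Sigma I J) \<le> card {M * x div q<..M * y div q}"
    by (intro card_inj_on_le) auto
  \<comment> \<open>The cardinalities count the jumps, that is, the increments of the floor
    functions from \<open>x\<close> to \<open>y\<close>.\<close>
  then have "(\<Sum>i\<in>I. m i * y div q - m i * x div q) \<le> M * y div q - M * x div q"
    using fin by (simp add: J_def)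
  then have "int (\<Sum>i\<in>I. m i * y div q - m i * x div q) \<le> int (M * y div q - M * x div q)"
    by (simp only: of_nat_le_iff)
  then have "(\<Sum>i\<in>I. int (m i * y div q) - int (m i * x div q))
      \<le> int (M * y div q) - int (M * x div q)"
    using xy by (simp add: of_nat_diff div_le_mono)
  then show ?thesis by (simp add: floor_excess_def M_def sum_subtractf)
qed

subsection \<open>Legendre's formula\<close>

text \<open>Any \<open>L \<ge> n\<close> serves as cut-off, since the multiplicity is less than
  \<open>n\<close>. A common cut-off later allows sums over \<open>n\<close> and \<open>e\<close> to
  be swapped.\<close>

lemma multiplicity_eq_sum:
  fixes p n :: nat
  assumes "prime p" "n > 0" "n \<le> L"
  shows "multiplicity p n = (\<Sum>e=1..L. if p ^ e dvd n then 1 else 0)"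
proof -
  have p: "p > 1" using assms(1) by (rule prime_gt_1_nat)
  have iff: "p ^ e dvd n \<longleftrightarrow> e \<le> multiplicity p n" for e
    using p assms(2) by (intro power_dvd_iff_le_multiplicity) auto
  have "multiplicity p n < p ^ multiplicity p n" using p by (intro power_gt_expt) simp
  also have "\<dots> \<le> n" using assms(2) by (intro dvd_imp_le multiplicity_dvd)
  finally have "{e \<in> {1..L}. p ^ e dvd n} = {1..multiplicity p n}"
    using assms(3) by (auto simp: iff)
  then show ?thesis by (simp flip: sum.inter_filter)
qed

text \<open>From \<open>n\<close> to \<open>Suc n\<close>, the quotient by \<open>p ^ e\<close>
  grows by one exactly when \<open>p ^ e\<close> divides \<open>Suc n\<close>.\<close>

lemma multiplicity_fact:
  fixes p n :: nat
  assumes "prime p" "n \<le> L"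
  shows "multiplicity p (fact n) = (\<Sum>e=1..L. n div p ^ e)"
  using assms(2)
proof (induction n)
  case (Suc n)
  have "multiplicity p (fact (Suc n) :: nat) = multiplicity p (Suc n) + multiplicity p (fact n :: nat)"
    unfolding fact_Suc of_nat_id
    using assms(1) by (intro prime_elem_multiplicity_mult_distrib) auto
  also have "\<dots> = (\<Sum>e=1..L. (if p ^ e dvd Suc n then 1 else 0) + n div p ^ e)"
    using Suc assms(1) multiplicity_eq_sum[of p "Suc n" L] by (simp add: sum.distrib)
  also have "\<dots> = (\<Sum>e=1..L. Suc n div p ^ e)"
    by (intro sum.cong refl) (simp add: div_Suc dvd_eq_mod_eq_0)
  finally show ?case .
qed simp

section \<open>Multinomial coefficients and their valuations\<close>

definition multinomial :: "'i set \<Rightarrow> ('i \<Rightarrow> nat) \<Rightarrow> nat" where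
  "multinomial I f = fact (sum f I) div (\<Prod>i\<in>I. fact (f i))"

lemma multinomial_mult_prod_fact:
  assumes "finite I"
  shows "multinomial I f * (\<Prod>i\<in>I. fact (f i)) = fact (sum f I)"
proof -
  have "int (\<Prod>i\<in>I. fact (f i)) dvd int (fact (sum f I))"
    using prod_fact_dvd_fact_sum[OF assms, of f] by simp
  then have "(\<Prod>i\<in>I. fact (f i)) dvd (fact (sum f I) :: nat)"
    by (simp only: int_dvd_int_iff)
  then show ?thesis by (simp add: multinomial_def)
qed

lemma multinomial_pos:
  assumes "finite I"
  shows "multinomial I f > 0"
  using multinomial_mult_prod_fact[OF assms, of f] by (metis fact_nonzero gr0I mult_0)

lemma multiplicity_multinomial:
  fixes p n :: nat
  assumes "prime p" "finite I" "sum m I * n \<le> L"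
  shows "int (multiplicity p (multinomial I (\<lambda>i. m i * n))) = (\<Sum>e=1..L. floor_excess I m (p ^ e) n)"
proof -
  have le: "m i * n \<le> L" if "i \<in> I" for i
  proof -
    have "m i \<le> sum m I" using assms(2) that by (simp add: member_le_sum)
    then show ?thesis using assms(3) by (meson le_trans mult_le_mono1)
  qed
  have pe: "prime_elem p" using assms(1) by simp
  have "multiplicity p (fact (sum m I * n) :: nat)
      = multiplicity p (multinomial I (\<lambda>i. m i * n) * (\<Prod>i\<in>I. fact (m i * n)))"
    using multinomial_mult_prod_fact[OF assms(2), of "\<lambda>i. m i * n"] by (simp add: sum_distrib_right)
  also have "\<dots> = multiplicity p (multinomial I (\<lambda>i. m i * n))
      + multiplicity p (\<Prod>i\<in>I. fact (m i * n) :: nat)"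
    using multinomial_pos[OF assms(2), of "\<lambda>i. m i * n"] assms(2) pe
    by (intro prime_elem_multiplicity_mult_distrib) auto
  also have "multiplicity p (\<Prod>i\<in>I. fact (m i * n) :: nat) = (\<Sum>i\<in>I. multiplicity p (fact (m i * n) :: nat))"
    using assms(2) pe by (intro prime_elem_multiplicity_prod_distrib) auto
  also have "\<dots> = (\<Sum>i\<in>I. \<Sum>e=1..L. m i * n div p ^ e)"
    using multiplicity_fact[OF assms(1) le] by simp
  also have "\<dots> = (\<Sum>e=1..L. \<Sum>i\<in>I. m i * n div p ^ e)"
    by (rule sum.swap)
  finally have "(\<Sum>e=1..L. sum m I * n div p ^ e) = multiplicity p (multinomial I (\<lambda>i. m i * n))
      + (\<Sum>e=1..L. \<Sum>i\<in>I. m i * n div p ^ e)"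
    using multiplicity_fact[OF assms(1,3)] by simp
  then have "int (\<Sum>e=1..L. sum m I * n div p ^ e) = int (multiplicity p (multinomial I (\<lambda>i. m i * n))
      + (\<Sum>e=1..L. \<Sum>i\<in>I. m i * n div p ^ e))"
    by (rule arg_cong)
  then show ?thesis by (simp add: floor_excess_def sum_subtractf)
qed

text \<open>The term for \<open>p ^ Suc e\<close> at \<open>p * n\<close> equals the term for
  \<open>p ^ e\<close> at \<open>n\<close>. The shift adds only a term for \<open>e = 0\<close>,
  which vanishes.\<close>

lemma multiplicity_multinomial_mult_prime:
  fixes p n :: nat
  assumes "prime p" "finite I"
  shows "multiplicity p (multinomial I (\<lambda>i. m i * (p * n))) = multiplicity p (multinomial I (\<lambda>i. m i * n))"
proof -
  define L where "L = sum m I * (p * n)"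
  have p: "p > 0" using assms(1) by (rule prime_gt_0_nat)
  then have "n \<le> p * n" by simp
  then have L: "sum m I * n \<le> L" unfolding L_def by (rule mult_le_mono2)
  have "int (multiplicity p (multinomial I (\<lambda>i. m i * (p * n))))
      = (\<Sum>e=1..Suc L. floor_excess I m (p ^ e) (p * n))"
    using assms by (intro multiplicity_multinomial) (auto simp: L_def)
  also have "\<dots> = (\<Sum>e=0..L. floor_excess I m (p ^ Suc e) (p * n))"
    using sum.shift_bounds_cl_Suc_ivl[of "\<lambda>e. floor_excess I m (p ^ e) (p * n)" 0 L] by simp
  also have "\<dots> = (\<Sum>e=0..L. floor_excess I m (p ^ e) n)"
    using p by (simp add: floor_excess_mult_cancel)
  also have "\<dots> = (\<Sum>e=1..L. floor_excess I m (p ^ e) n)"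
    using floor_excess_1[of I m n] by (simp add: sum.atLeast_Suc_atMost)
  also have "\<dots> = int (multiplicity p (multinomial I (\<lambda>i. m i * n)))"
    using assms L by (intro multiplicity_multinomial[symmetric])
  finally show ?thesis by simp
qed

lemma multiplicity_multinomial_mult_prime_power:
  fixes p n :: nat
  assumes "prime p" "finite I"
  shows "multiplicity p (multinomial I (\<lambda>i. m i * (p ^ j * n))) = multiplicity p (multinomial I (\<lambda>i. m i * n))"
proof (induction j)
  case (Suc j)
  then show ?case
    using multiplicity_multinomial_mult_prime[OF assms, of m "p ^ j * n"] by (simp add: mult.assoc)
qed simp

section \<open>Divisibility of the products, one prime at a time\<close>

lemma prod_multinomial_dvd:
  fixes k t :: nat
  assumes fin: "finite I"
    and pos: "\<And>i. i \<in> I \<Longrightarrow> m i > 0"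
    and cop: "\<And>i j. i \<in> I \<Longrightarrow> j \<in> I \<Longrightarrow> i \<noteq> j \<Longrightarrow> coprime (m i) (m j)"
    and dvd: "\<And>i. i \<in> I \<Longrightarrow> m i dvd sum m I"
    and k: "k > 0"
  shows "(\<Prod>n=1..t. multinomial I (\<lambda>i. m i * n)) dvd (\<Prod>n=1..t. multinomial I (\<lambda>i. m i * (k * n)))"
proof (rule multiplicity_le_imp_dvd)
  show "(\<Prod>n=1..t. multinomial I (\<lambda>i. m i * n)) \<noteq> 0"
    using multinomial_pos[OF fin] by (simp add: prod_zero_iff gr0_conv_Suc)
next
  fix p :: nat assume p: "prime p"
  define v where "v n = multiplicity p (multinomial I (\<lambda>i. m i * n))" for n
  \<comment> \<open>\<open>l\<close> is the part of \<open>k\<close> prime to \<open>p\<close>; the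
    removed power of \<open>p\<close> leaves the valuations unchanged.\<close>
  obtain l where l: "k = p ^ multiplicity p k * l" "\<not> p dvd l"
    using multiplicity_decompose'[of k p] k p by (metis not_prime_unit not_gr0)
  have cl: "coprime l (p ^ e)" for e
    using prime_imp_coprime[OF p l(2)] by (simp add: coprime_commute)
  have v_mult_k: "v (k * n) = v (l * n)" for n
    unfolding v_def by (subst l(1)) (simp add: multiplicity_multinomial_mult_prime_power[OF p fin] mult.assoc)
  have prod: "multiplicity p (\<Prod>n=1..t. multinomial I (\<lambda>i. m i * g n)) = (\<Sum>n=1..t. v (g n))" for g
    unfolding v_def using p multinomial_pos[OF fin]
    by (intro prime_elem_multiplicity_prod_distrib) (auto simp: image_iff dest: sym)
  \<comment> \<open>One cut-off for all arguments up to \<open>l * t\<close>, hence for both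
    \<open>n\<close> and \<open>l * n\<close> with \<open>n \<le> t\<close>.\<close>
  define L where "L = sum m I * (l * t)"
  have "l > 0" using l k by (auto intro: Nat.gr0I)
  have v_sum: "int (v n) = (\<Sum>e=1..L. floor_excess I m (p ^ e) n)" if "n \<le> l * t" for n
    unfolding v_def using that by (intro multiplicity_multinomial p fin) (simp add: L_def)
  have "int (\<Sum>n=1..t. v n) = (\<Sum>n=1..t. \<Sum>e=1..L. floor_excess I m (p ^ e) n)"
    unfolding of_nat_sum using \<open>l > 0\<close>
    by (intro sum.cong refl v_sum) (auto intro: le_trans[of _ t])
  also have "\<dots> = (\<Sum>e=1..L. \<Sum>n=1..t. floor_excess I m (p ^ e) n)"
    by (rule sum.swap)
  also have "\<dots> \<le> (\<Sum>e=1..L. \<Sum>n=1..t. floor_excess I m (p ^ e) (l * n))"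
  proof (rule sum_mono)
    fix e
    have "p ^ e > 0" using p by (simp add: prime_gt_0_nat)
    then show "(\<Sum>n=1..t. floor_excess I m (p ^ e) n) \<le> (\<Sum>n=1..t. floor_excess I m (p ^ e) (l * n))"
      using cl by (intro sum_periodic_mult_ge[where q = "p ^ e"] floor_excess_mono[OF fin pos cop dvd] floor_excess_mod)
  qed
  also have "\<dots> = (\<Sum>n=1..t. \<Sum>e=1..L. floor_excess I m (p ^ e) (l * n))"
    by (rule sum.swap)
  also have "\<dots> = int (\<Sum>n=1..t. v (l * n))"
    unfolding of_nat_sum by (intro sum.cong refl v_sum[symmetric]) simp
  finally have "(\<Sum>n=1..t. v n) \<le> (\<Sum>n=1..t. v (k * n))"
    by (simp only: v_mult_k of_nat_le_iff)
  then show "multiplicity p (\<Prod>n=1..t. multinomial I (\<lambda>i. m i * n))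
      \<le> multiplicity p (\<Prod>n=1..t. multinomial I (\<lambda>i. m i * (k * n)))"
    by (simp only: prod[of "\<lambda>n. n"] prod[of "\<lambda>n. k * n"])
qed

lemma multinomial_seq_eq_multinomial:
  "multinomial_seq s m n = int (multinomial {1..s} (\<lambda>i. m i * n))"
  by (simp add: multinomial_seq_def multinomial_def zdiv_int sum_distrib_right)

theorem theorem6:
  fixes s :: nat and m :: "nat \<Rightarrow> nat"
  assumes "s \<ge> 1"
    and "\<And>i. i \<in> {1..s} \<Longrightarrow> m i > 0"
    and "\<And>i j. i \<in> {1..s} \<Longrightarrow> j \<in> {1..s} \<Longrightarrow> i \<noteq> j \<Longrightarrow> coprime (m i) (m j)"
    and "\<And>i. i \<in> {1..s} \<Longrightarrow> m i dvd (\<Sum>j=1..s. m j)"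
  shows "mean_divisible (multinomial_seq s m)"
  unfolding mean_divisible_def
proof (intro conjI allI impI)
  show "multinomial_seq s m n \<noteq> 0" for n
    using multinomial_pos[of "{1..s}" "\<lambda>i. m i * n"] by (simp add: multinomial_seq_eq_multinomial)
next
  fix k t :: nat assume "k \<ge> 1"
  then have "(\<Prod>n=1..t. multinomial {1..s} (\<lambda>i. m i * n))
      dvd (\<Prod>n=1..t. multinomial {1..s} (\<lambda>i. m i * (k * n)))"
    using assms by (intro prod_multinomial_dvd) auto
  then have "int (\<Prod>n=1..t. multinomial {1..s} (\<lambda>i. m i * n))
      dvd int (\<Prod>n=1..t. multinomial {1..s} (\<lambda>i. m i * (k * n)))"
    by (simp only: int_dvd_int_iff)
  then show "(\<Prod>n=1..t. multinomial_seq s m n) dvd (\<Prod>n=1..t. multinomial_seq s m (k * n))"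
    by (simp add: multinomial_seq_eq_multinomial)
qed

end
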